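(* Let $a$ be a real number with $a\ne -1,-2,\dots$, let $s$ be a positive integer and let $x,y\in[-1,1)$. Then \begin{align*} \sum_{n=1}^\infty\frac{y^n\sum_{j=1}^{n-1}\frac{x^{n-j}}{j}+x^n\sum_{j=1}^{n-1}\frac{y^{n-j}}{j}}{(n+a)^s} &=s\,\mathrm{Li}_{s+1}(a,xy)-\sum_{j=1}^s\mathrm{Li}_j(a,x)\,\mathrm{Li}_{s+1-j}(a,y)\\ &\quad+\mathrm{Li}_s(a,xy)\bigl(\mathrm{Li}_1(x)+\mathrm{Li}_1(y)\bigr). \end{align*}
   Context: The parametric polylogarithm is $\mathrm{Li}_s(a,x)=\sum_{n=1}^\infty\frac{x^n}{(n+a)^s}$ for $\Re(s)\ge1$, $-1\le x<1$, and the classical polylogarithm is $\mathrm{Li}_s(x)=\sum_{n=1}^\infty\frac{x^n}{n^s}$, with $\mathrm{Li}_1(x)=-\ln(1-x)$.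
   Formalization: The single case s = 1, x = y = -1 is excluded: there Li_1(a,xy) = Li_1(a,1) = Σ 1/(n+a) diverges, and so does the left-hand series, whose terms behave like -2 ln 2 / n, so neither side is defined. *)

theory Defs
  imports Complex_Main
begin

text \<open>
  The order \<open>s\<close> is a natural number and the power is the ordinary integer power, so that
  \<open>(n + a) ^ s\<close> has its usual meaning also for the finitely many \<open>n\<close> with \<open>n + a < 0\<close>.
  Series over \<open>n \<ge> 1\<close> are indexed by \<open>Suc n\<close>. They are limits of partial sums, not
  unconditional sums: at \<open>s = 1\<close>, \<open>x = - 1\<close> the convergence is only conditional.
\<close>

definition parametric_polylog :: "nat \<Rightarrow> real \<Rightarrow> real \<Rightarrow> real" where
  "parametric_polylog s a x = (\<Sum>n. x ^ Suc n / (real (Suc n) + a) ^ s)"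

definition polylog :: "nat \<Rightarrow> real \<Rightarrow> real" where
  "polylog s x = (\<Sum>n. x ^ Suc n / real (Suc n) ^ s)"

end

theory Submission
  imports Defs "HOL-Analysis.Uniform_Limit" "HOL-Analysis.Summation_Tests"
begin

text \<open>
  Multiply the partial sums up to \<open>N\<close> and sum over \<open>j\<close>. Off the diagonal, the geometric sum
  \<open>\<Sum>j=1..s. 1 / (A ^ j * B ^ (s + 1 - j)) = (1 / A ^ s - 1 / B ^ s) / (B - A)\<close> with
  \<open>A = m + a\<close>, \<open>B = n + a\<close> has the denominator \<open>n - m\<close>, free of \<open>a\<close>. Summing the first term over
  \<open>n\<close> gives a partial sum of \<open>- ln (1 - y)\<close> for \<open>n > m\<close> and the inner sums of the left-hand side
  for \<open>n < m\<close>, and similarly for the second. This is an exact identity for every \<open>N\<close>, and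
  \<open>N \<longrightarrow> \<infinity>\<close> only needs the convolution of an absolutely summable sequence with a
  convergent one.
\<close>

section \<open>Exact identity for the partial sums\<close>

lemma geometric_sum_inverse:
  fixes A B :: real
  assumes "A \<noteq> 0" "B \<noteq> 0" "A \<noteq> B"
  shows "(\<Sum>j=1..s. 1 / (A ^ j * B ^ (s + 1 - j))) = (1 / A ^ s - 1 / B ^ s) / (B - A)"
proof -
  \<comment> \<open>\<open>S\<close> is the cofactor of \<open>u - v\<close> in
    \<open>u ^ s - v ^ s\<close> for \<open>u = 1 / A\<close> and \<open>v = 1 / B\<close>.\<close>
  define S where "S = (\<Sum>i<s. (1 / B) ^ (s - Suc i) * (1 / A) ^ i)"
  have "(\<Sum>j=1..s. 1 / (A ^ j * B ^ (s + 1 - j))) = (\<Sum>i<s. 1 / (A ^ Suc i * B ^ (s - i)))"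
    by (simp add: sum.atLeast1_atMost_eq)
  also have "\<dots> = S / (A * B)"
    unfolding S_def sum_divide_distrib
  proof (rule sum.cong)
    fix i assume "i \<in> {..<s}"
    then have "s - i = Suc (s - Suc i)"
      by auto
    then show "1 / (A ^ Suc i * B ^ (s - i)) = (1 / B) ^ (s - Suc i) * (1 / A) ^ i / (A * B)"
      by (simp add: power_divide)
  qed simp
  also have "\<dots> = (1 / A ^ s - 1 / B ^ s) / (B - A)"
  proof -
    have "1 / A ^ s - 1 / B ^ s = (1 / A - 1 / B) * S"
      using power_diff_sumr2[of "1 / A" s "1 / B"] by (simp add: S_def power_divide)
    also have "1 / A - 1 / B = (B - A) / (A * B)"
      using assms by (simp add: field_simps)
    finally show ?thesis
      using assms by simp
  qed
  finally show ?thesis .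
qed

text \<open>The term \<open>n = m\<close> of the left-hand side is \<open>0\<close>, because \<open>y ^ m / 0 = 0\<close>.\<close>

lemma sum_power_divide_diff:
  fixes y :: real
  assumes "1 \<le> m" "m \<le> N"
  shows "(\<Sum>n=1..N. y ^ n / (real n - real m)) =
    y ^ m * (\<Sum>k=1..N-m. y ^ k / real k) - (\<Sum>j=1..m-1. y ^ (m - j) / real j)"
proof -
  let ?f = "\<lambda>n. y ^ n / (real n - real m)"
  have "{1..N} = insert m ({1..m-1} \<union> {m+1..N})"
    using assms by auto
  moreover have "m \<notin> {1..m-1} \<union> {m+1..N}" "{1..m-1} \<inter> {m+1..N} = {}"
    using assms by auto
  ultimately have "sum ?f {1..N} = sum ?f {1..m-1} + sum ?f {m+1..N}"
    by (simp add: sum.union_disjoint)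
  also have "sum ?f {1..m-1} = (\<Sum>j=1..m-1. - (y ^ (m - j) / real j))"
    by (rule sum.reindex_bij_witness[of _ "\<lambda>j. m - j" "\<lambda>n. m - n"])
      (auto simp: of_nat_diff field_simps)
  also have "sum ?f {m+1..N} = (\<Sum>k=1..N-m. y ^ m * (y ^ k / real k))"
    by (rule sum.reindex_bij_witness[of _ "\<lambda>k. m + k" "\<lambda>n. n - m"])
      (auto simp: of_nat_diff power_add[symmetric])
  finally show ?thesis
    by (simp add: sum_negf sum_distrib_left)
qed

text \<open>The product of partial sums runs over the whole square \<open>1 <= m, n <= N\<close>, so
  the logarithmic sums attached to \<open>n\<close> stop at \<open>N - n\<close>. This makes the
  last sum a convolution.\<close>

lemma polylog_partial_sums:
  fixes a x y :: real
  assumes a: "\<And>k::nat. k \<ge> 1 \<Longrightarrow> a \<noteq> - real k"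
  shows "(\<Sum>n=1..N. (y ^ n * (\<Sum>j=1..n-1. x ^ (n - j) / real j)
              + x ^ n * (\<Sum>j=1..n-1. y ^ (n - j) / real j)) / (real n + a) ^ s) =
    real s * (\<Sum>n=1..N. (x * y) ^ n / (real n + a) ^ (s + 1))
    - (\<Sum>j=1..s. (\<Sum>n=1..N. x ^ n / (real n + a) ^ j) *
        (\<Sum>n=1..N. y ^ n / (real n + a) ^ (s + 1 - j)))
    + (\<Sum>n=1..N. (x * y) ^ n / (real n + a) ^ s *
        ((\<Sum>k=1..N-n. x ^ k / real k) + (\<Sum>k=1..N-n. y ^ k / real k)))"
proof -
  define L where "L z n = (\<Sum>k=1..N-n. z ^ k / real k)" for z :: real and n
  define H where "H z n = (\<Sum>j=1..n-1. z ^ (n - j) / real j)" for z :: real and n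
  \<comment> \<open>\<open>E x y\<close> and \<open>E y x\<close> will be the two halves of the
    off-diagonal part.\<close>
  define E where "E z w = (\<Sum>m=1..N. \<Sum>n=1..N. z ^ m / (real m + a) ^ s * (w ^ n / (real n - real m)))"
    for z w :: real
  have nz: "real n + a \<noteq> 0" if "n \<ge> 1" for n
    using a[OF that] by linarith
  have E: "E z w = (\<Sum>n=1..N. (z * w) ^ n / (real n + a) ^ s * L w n)
      - (\<Sum>n=1..N. z ^ n * H w n / (real n + a) ^ s)" for z w
  proof -
    have "E z w = (\<Sum>m=1..N. z ^ m / (real m + a) ^ s * (w ^ m * L w m - H w m))"
      unfolding E_def sum_distrib_left[symmetric] L_def H_def
      by (intro sum.cong refl arg_cong2[of _ _ _ _ "(*)"] sum_power_divide_diff) auto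
    then show ?thesis
      by (simp add: algebra_simps power_mult_distrib sum_subtractf diff_divide_distrib)
  qed
  have "(\<Sum>j=1..s. (\<Sum>n=1..N. x ^ n / (real n + a) ^ j) *
        (\<Sum>n=1..N. y ^ n / (real n + a) ^ (s + 1 - j))) =
      (\<Sum>j=1..s. \<Sum>m=1..N. \<Sum>n=1..N. x ^ m * y ^ n *
        (1 / ((real m + a) ^ j * (real n + a) ^ (s + 1 - j))))"
    by (simp add: sum_product)
  also have "\<dots> = (\<Sum>m=1..N. \<Sum>j=1..s. \<Sum>n=1..N. x ^ m * y ^ n *
        (1 / ((real m + a) ^ j * (real n + a) ^ (s + 1 - j))))"
    by (rule sum.swap)
  also have "\<dots> = (\<Sum>m=1..N. \<Sum>n=1..N. \<Sum>j=1..s. x ^ m * y ^ n *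
        (1 / ((real m + a) ^ j * (real n + a) ^ (s + 1 - j))))"
    by (intro sum.cong refl sum.swap)
  \<comment> \<open>For \<open>m = n\<close> the last two terms are quotients by \<open>0\<close>
    and vanish, so the square need not be split.\<close>
  also have "\<dots> = (\<Sum>m=1..N. \<Sum>n=1..N.
      (if m = n then real s * ((x * y) ^ n / (real n + a) ^ (s + 1)) else 0)
      + x ^ m / (real m + a) ^ s * (y ^ n / (real n - real m))
      + y ^ n / (real n + a) ^ s * (x ^ m / (real m - real n)))"
  proof (intro sum.cong refl)
    fix m n assume mn: "m \<in> {1..N}" "n \<in> {1..N}"
    show "(\<Sum>j=1..s. x ^ m * y ^ n * (1 / ((real m + a) ^ j * (real n + a) ^ (s + 1 - j)))) =
      (if m = n then real s * ((x * y) ^ n / (real n + a) ^ (s + 1)) else 0)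
      + x ^ m / (real m + a) ^ s * (y ^ n / (real n - real m))
      + y ^ n / (real n + a) ^ s * (x ^ m / (real m - real n))"
    proof (cases "m = n")
      case True
      \<comment> \<open>The exponents add up to \<open>s + 1\<close> for every \<open>j\<close>,
        hence the factor \<open>s\<close>.\<close>
      have "(\<Sum>j=1..s. 1 / ((real n + a) ^ j * (real n + a) ^ (s + 1 - j))) =
          (\<Sum>j=1..s. 1 / (real n + a) ^ (s + 1))"
        by (intro sum.cong refl) (simp flip: power_add power_Suc)
      then show ?thesis
        unfolding True sum_distrib_left[symmetric] by (simp add: power_mult_distrib)
    next
      case False
      have "(\<Sum>j=1..s. 1 / ((real m + a) ^ j * (real n + a) ^ (s + 1 - j))) =
          (1 / (real m + a) ^ s - 1 / (real n + a) ^ s) / (real n - real m)"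
        using geometric_sum_inverse[of "real m + a" "real n + a" s] nz mn False by simp
      moreover have "x ^ m / (real m - real n) = - (x ^ m / (real n - real m))"
        by (metis minus_diff_eq minus_divide_right)
      \<comment> \<open>The \<open>0\<close> matches the value of the \<open>if\<close>, so that
        rewriting alone closes the goal.\<close>
      moreover have "X * Y * ((1 / A - 1 / B) / d) = 0 + X / A * (Y / d) + Y / B * - (X / d)"
        for X Y A B d :: real
        by (simp add: right_diff_distrib diff_divide_distrib mult_ac)
      ultimately show ?thesis
        unfolding sum_distrib_left[symmetric] using False by (simp only: if_False)
    qed
  qed
  also have "\<dots> = real s * (\<Sum>n=1..N. (x * y) ^ n / (real n + a) ^ (s + 1)) + E x y
      + (\<Sum>m=1..N. \<Sum>n=1..N. y ^ n / (real n + a) ^ s * (x ^ m / (real m - real n)))"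
    by (simp add: sum.distrib E_def sum_distrib_left)
  also have "(\<Sum>m=1..N. \<Sum>n=1..N. y ^ n / (real n + a) ^ s * (x ^ m / (real m - real n))) = E y x"
    unfolding E_def by (rule sum.swap)
  finally show ?thesis
    unfolding E L_def[symmetric] H_def[symmetric]
    by (simp add: algebra_simps sum.distrib add_divide_distrib)
qed

section \<open>Convergence of the series\<close>

text \<open>Leibniz criterion at the boundary point -1. Since \<open>a\<close> may be very negative,
  \<open>k\<close> terms are dropped first: with \<open>k >= - a\<close> the remaining denominators
  are positive and increasing.\<close>

lemma summable_inverse_power_alternating:
  fixes a :: real
  assumes "j \<ge> 1"
  shows "summable (\<lambda>n. 1 / (real (Suc n) + a) ^ j * (- 1) ^ n)"
proof -
  obtain k :: nat where k: "- a \<le> real k"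
    using real_arch_simple by blast
  have "summable (\<lambda>n. (- 1) ^ n * (1 / (real (Suc (n + k)) + a) ^ j))"
  proof (rule summable_Leibniz(1))
    have "filterlim (\<lambda>n. real (Suc (n + k)) + a) at_top sequentially"
      by (rule filterlim_at_top_mono[OF filterlim_real_sequentially]) (use k in auto)
    then have "((\<lambda>n. 1 / (real (Suc (n + k)) + a)) \<longlonglongrightarrow> 0)"
      by (rule tendsto_divide_0[OF tendsto_const filterlim_at_top_imp_at_infinity])
    then have "((\<lambda>n. (1 / (real (Suc (n + k)) + a)) ^ j) \<longlonglongrightarrow> 0 ^ j)"
      by (rule tendsto_power)
    then show "(\<lambda>n. 1 / (real (Suc (n + k)) + a) ^ j) \<longlonglongrightarrow> 0"
      using assms by (simp add: power_divide zero_power)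
    have "1 / (real (Suc (Suc n + k)) + a) ^ j \<le> 1 / (real (Suc (n + k)) + a) ^ j" for n
      using k by (intro divide_left_mono power_mono mult_pos_pos zero_less_power) auto
    then show "monoseq (\<lambda>n. 1 / (real (Suc (n + k)) + a) ^ j)"
      by (intro decseq_imp_monoseq decseq_SucI)
  qed
  then have "summable (\<lambda>n. (- 1) ^ k * ((- 1) ^ n * (1 / (real (Suc (n + k)) + a) ^ j)))"
    by (rule summable_mult)
  then have "summable (\<lambda>n. 1 / (real (Suc (n + k)) + a) ^ j * (- 1) ^ (n + k))"
    by (simp add: power_add mult_ac)
  then show ?thesis
    by (rule summable_iff_shift[THEN iffD1])
qed

text \<open>A power series that converges at -1 converges absolutely inside the unit disc.\<close>

lemma summable_abs_parametric_polylog: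
  fixes a x :: real
  assumes "j \<ge> 1" "\<bar>x\<bar> < 1"
  shows "summable (\<lambda>n. \<bar>x ^ Suc n / (real (Suc n) + a) ^ j\<bar>)"
proof -
  have "summable (\<lambda>n. norm (1 / (real (Suc n) + a) ^ j * x ^ n))"
    by (rule powser_insidea[OF summable_inverse_power_alternating]) (use assms in auto)
  then have "summable (\<lambda>n. \<bar>x\<bar> * norm (1 / (real (Suc n) + a) ^ j * x ^ n))"
    by (rule summable_mult)
  then show ?thesis
    by (simp add: abs_mult power_abs)
qed

lemma summable_parametric_polylog:
  fixes a x :: real
  assumes "j \<ge> 1" "x \<in> {-1..<1}"
  shows "summable (\<lambda>n. x ^ Suc n / (real (Suc n) + a) ^ j)"
proof (cases "x = -1")
  case True
  then show ?thesis
    using summable_minus[OF summable_inverse_power_alternating[OF assms(1), of a]] by simp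
next
  case False
  then have "\<bar>x\<bar> < 1"
    using assms by auto
  then show ?thesis
    using summable_abs_parametric_polylog[OF assms(1)] by (simp only: summable_rabs_cancel)
qed

text \<open>Serves the case \<open>x = y = -1\<close>, where \<open>x * y = 1\<close>. After a shift
  by \<open>k >= - a\<close> the terms are dominated by \<open>1 / (n + 1) ^ s\<close>.\<close>

lemma summable_abs_inverse_power_shift:
  fixes a :: real
  assumes "s \<ge> 2"
  shows "summable (\<lambda>n. \<bar>1 / (real (Suc n) + a) ^ s\<bar>)"
proof -
  obtain k :: nat where k: "- a \<le> real k"
    using real_arch_simple by blast
  have "summable (\<lambda>n. inverse (real (Suc n) ^ s))"
    using inverse_power_summable[OF assms, where 'a = real]
    by (rule summable_Suc_iff[THEN iffD2])
  then have "summable (\<lambda>n. \<bar>1 / (real (Suc (n + k)) + a) ^ s\<bar>)"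
  proof (rule summable_comparison_test'[where N = 0])
    fix n
    have "real (Suc n) \<le> real (Suc (n + k)) + a"
      using k by simp
    then have "real (Suc n) ^ s \<le> (real (Suc (n + k)) + a) ^ s"
      by (intro power_mono) auto
    moreover have "real (Suc n) ^ s > 0"
      by simp
    ultimately show "norm \<bar>1 / (real (Suc (n + k)) + a) ^ s\<bar> \<le> inverse (real (Suc n) ^ s)"
      by (simp add: divide_inverse le_imp_inverse_le del: of_nat_Suc)
  qed
  then show ?thesis
    by (rule summable_iff_shift[THEN iffD1])
qed

section \<open>Passage to the limit\<close>

text \<open>Tannery's theorem: a bound \<open>K\<close> for \<open>L\<close> gives a summable
  majorant independent of \<open>N\<close>, so the limit may be taken term by term.\<close>

lemma convolution_tendsto:
  fixes c L :: "nat \<Rightarrow> real"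
  assumes c: "summable (\<lambda>n. \<bar>c n\<bar>)" and L: "L \<longlonglongrightarrow> l"
  shows "(\<lambda>N. \<Sum>n<N. c n * L (N - Suc n)) \<longlonglongrightarrow> (\<Sum>n. c n) * l"
proof -
  have "Bseq L"
    using L by (rule convergentI[THEN convergent_imp_Bseq])
  then obtain K where K: "\<And>n. norm (L n) \<le> K"
    unfolding Bseq_def by blast
  \<comment> \<open>Extension by \<open>0\<close> turns the sum of growing length into a series; for
    fixed \<open>n\<close> it changes nothing once \<open>N > n\<close>.\<close>
  define f where "f n N = (if n < N then c n * L (N - Suc n) else 0)" for n N
  have "(\<lambda>N. \<Sum>n. f n N) \<longlonglongrightarrow> (\<Sum>n. c n * l)"
  proof (rule tannerys_theorem[THEN conjunct2, THEN conjunct2])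
    fix n
    have "(\<lambda>N. c n * L (N - Suc n)) \<longlonglongrightarrow> c n * l"
      by (intro tendsto_mult_left filterlim_compose[OF L] filterlim_minus_const_nat_at_top)
    moreover have "\<forall>\<^sub>F N in sequentially. c n * L (N - Suc n) = f n N"
      using eventually_gt_at_top[of n] by eventually_elim (simp add: f_def)
    ultimately show "f n \<longlonglongrightarrow> c n * l"
      by (rule Lim_transform_eventually)
  next
    have "norm (f n N) \<le> \<bar>c n\<bar> * K" for n N
      using K[of "N - Suc n"] K[of 0] norm_ge_zero[of "L 0"]
      by (auto simp: f_def abs_mult intro!: mult_left_mono mult_nonneg_nonneg simp del: norm_ge_zero)
    then show "\<forall>\<^sub>F (n, N) in sequentially \<times>\<^sub>F sequentially. norm (f n N) \<le> \<bar>c n\<bar> * K"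
      by (simp add: case_prod_unfold)
    show "summable (\<lambda>n. \<bar>c n\<bar> * K)"
      using c by (rule summable_mult2)
  qed simp
  moreover have "(\<Sum>n. f n N) = (\<Sum>n<N. c n * L (N - Suc n))" for N
    by (subst suminf_finite[of "{..<N}"]) (auto simp: f_def)
  moreover have "(\<Sum>n. c n * l) = (\<Sum>n. c n) * l"
    using summable_rabs_cancel[OF c] by (rule suminf_mult2[symmetric])
  ultimately show ?thesis
    by simp
qed

text \<open>The case \<open>s = 1\<close>, \<open>x = y = -1\<close> is excluded because there
  \<open>x * y = 1\<close>, and the series behind \<open>parametric_polylog 1 a 1\<close> diverges
  like the harmonic series.\<close>

theorem theorem2p6:
  fixes a x y :: real and s :: nat
  assumes "\<And>k::nat. k \<ge> 1 \<Longrightarrow> a \<noteq> - real k"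
    and "s \<ge> 1"
    and "x \<in> {-1..<1}" and "y \<in> {-1..<1}"
    and "\<not> (s = 1 \<and> x = -1 \<and> y = -1)"
  shows "(\<lambda>k. let n = Suc k in
            (y ^ n * (\<Sum>j=1..n-1. x ^ (n - j) / real j)
              + x ^ n * (\<Sum>j=1..n-1. y ^ (n - j) / real j)) / (real n + a) ^ s)
         sums
         (real s * parametric_polylog (s + 1) a (x * y)
          - (\<Sum>j=1..s. parametric_polylog j a x * parametric_polylog (s + 1 - j) a y)
          + parametric_polylog s a (x * y) * (polylog 1 x + polylog 1 y))"
proof -
  have P: "(\<lambda>N. \<Sum>n=1..N. z ^ n / (real n + a) ^ j) \<longlonglongrightarrow> parametric_polylog j a z"
    if "summable (\<lambda>n. z ^ Suc n / (real (Suc n) + a) ^ j)" for z j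
    using summable_LIMSEQ[OF that] by (simp add: parametric_polylog_def sum.atLeast1_atMost_eq)
  \<comment> \<open>\<open>polylog 1\<close> is the case \<open>a = 0\<close> of the parametric
    series of order 1.\<close>
  have L: "(\<lambda>N. \<Sum>k=1..N. z ^ k / real k) \<longlonglongrightarrow> polylog 1 z" if "z \<in> {-1..<1}" for z
    using summable_LIMSEQ[OF summable_parametric_polylog[of 1 z 0]] that
    by (simp add: polylog_def sum.atLeast1_atMost_eq)
  \<comment> \<open>Used for \<open>j = s\<close> in the convolution and for
    \<open>j = s + 1\<close>. Since \<open>x, y < 1\<close>, the product has modulus 1 only for
    \<open>x = y = -1\<close>, and then the excluded case forces \<open>s >= 2\<close>.\<close>
  have abs_summable: "summable (\<lambda>n. \<bar>(x * y) ^ Suc n / (real (Suc n) + a) ^ j\<bar>)" if "j \<ge> s" for j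
  proof (cases "x = -1 \<and> y = -1")
    case True
    then show ?thesis
      using summable_abs_inverse_power_shift[of j a] assms(2,5) that by simp
  next
    case False
    have "\<bar>x * y\<bar> < 1"
    proof (cases "x = -1")
      case True
      then show ?thesis
        using False assms(4) by auto
    next
      case False
      then have "\<bar>x\<bar> < 1" "\<bar>y\<bar> \<le> 1"
        using assms(3,4) by auto
      then show ?thesis
        using mult_left_mono[of "\<bar>y\<bar>" 1 "\<bar>x\<bar>"] by (simp add: abs_mult)
    qed
    then show ?thesis
      using summable_abs_parametric_polylog[of j "x * y" a] assms(2) that by simp
  qed
  define Q where "Q N = (\<Sum>k=1..N. x ^ k / real k) + (\<Sum>k=1..N. y ^ k / real k)" for N
  have "(\<lambda>N. \<Sum>n<N. (x * y) ^ Suc n / (real (Suc n) + a) ^ s * Q (N - Suc n))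
      \<longlonglongrightarrow> parametric_polylog s a (x * y) * (polylog 1 x + polylog 1 y)"
    unfolding parametric_polylog_def Q_def
    by (intro convolution_tendsto abs_summable tendsto_add L assms(3,4)) simp
  then have conv: "(\<lambda>N. \<Sum>n=1..N. (x * y) ^ n / (real n + a) ^ s * Q (N - n))
      \<longlonglongrightarrow> parametric_polylog s a (x * y) * (polylog 1 x + polylog 1 y)"
    by (simp add: sum.atLeast1_atMost_eq)
  \<comment> \<open>The factors may converge only conditionally, but the limit concerns finitely
    many products of partial sums, so no Cauchy product is involved.\<close>
  have "(\<lambda>N. real s * (\<Sum>n=1..N. (x * y) ^ n / (real n + a) ^ (s + 1))
      - (\<Sum>j=1..s. (\<Sum>n=1..N. x ^ n / (real n + a) ^ j) *
          (\<Sum>n=1..N. y ^ n / (real n + a) ^ (s + 1 - j)))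
      + (\<Sum>n=1..N. (x * y) ^ n / (real n + a) ^ s * Q (N - n)))
    \<longlonglongrightarrow> real s * parametric_polylog (s + 1) a (x * y)
      - (\<Sum>j=1..s. parametric_polylog j a x * parametric_polylog (s + 1 - j) a y)
      + parametric_polylog s a (x * y) * (polylog 1 x + polylog 1 y)"
    by (intro tendsto_add tendsto_diff tendsto_mult tendsto_sum tendsto_const conv P
        summable_parametric_polylog summable_rabs_cancel[OF abs_summable] assms(3,4)) auto
  then have "(\<lambda>N. \<Sum>n=1..N. (y ^ n * (\<Sum>j=1..n-1. x ^ (n - j) / real j)
              + x ^ n * (\<Sum>j=1..n-1. y ^ (n - j) / real j)) / (real n + a) ^ s)
    \<longlonglongrightarrow> real s * parametric_polylog (s + 1) a (x * y)
      - (\<Sum>j=1..s. parametric_polylog j a x * parametric_polylog (s + 1 - j) a y)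
      + parametric_polylog s a (x * y) * (polylog 1 x + polylog 1 y)"
    by (simp only: polylog_partial_sums[OF assms(1)] Q_def)
  then show ?thesis
    unfolding sums_def Let_def by (simp add: sum.atLeast1_atMost_eq)
qed

end
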